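(* There is an infinite family of connected graphs $G$ with classical cop number $c(G) = 2$ and maximum degree $\Delta(G) = 3$ while neither $c_V(G)$, $c_{V, \mathrm{r}}(G)$, $c_E(G)$ nor $c_{E, \mathrm{r}}(G)$ can be bounded by any function of $c(G)$ and the maximum degree $\Delta(G)$.
   Context: Cops and Robber is played on a connected graph $G=(V,E)$ by two players: one controls $k$ cops, the other a single robber. First the cops choose starting positions, then the robber chooses a starting vertex; afterwards the players alternate turns, and in a turn each piece may make one move (no piece is forced to move). The robber always sits on vertices and moves along edges to adjacent vertices. In the classical game the cops also sit on vertices and move along edges, and the cops win if some cop occupies the robber's vertex (capture); $c(G)$ is the minimum number of cops that can guarantee capture in finitely many turns. In the surrounding versions, let $v_r$ denote the robber's current vertex. Vertex version: cops sit on vertices and move along edges; they win (surround the robber) when every neighbor of $v_r$ is occupied by a cop; $c_V(G)$ is the minimum number of cops guaranteeing an eventual surround. Edge version: cops sit on edges and a cop on edge $e$ may move to any edge sharing an endpoint with $e$; they win when every edge incident to $v_r$ is occupied by a cop; $c_E(G)$ is the corresponding minimum. Restrictive vertex version (cop number $c_{V,\mathrm{r}}(G)$): same as the vertex version, but after the robber's turn no cop may be on $v_r$ (in particular the robber may not move onto a vertex occupied by a cop, and if a cop moves onto $v_r$ the robber must leave that vertex on his next turn). Restrictive edge version (cop number $c_{E,\mathrm{r}}(G)$): same as the edge version, but the robber may not move along an edge currently occupied by a cop. $\Delta(G)$ denotes the maximum degree of $G$. *)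

theory Defs
  imports Main
begin

definition simple_graph :: "nat set \<Rightarrow> (nat \<Rightarrow> nat \<Rightarrow> bool) \<Rightarrow> bool" where
  "simple_graph V E \<longleftrightarrow> finite V \<and>
     (\<forall>u v. E u v \<longrightarrow> u \<in> V \<and> v \<in> V \<and> E v u \<and> u \<noteq> v)"

definition connected_graph :: "nat set \<Rightarrow> (nat \<Rightarrow> nat \<Rightarrow> bool) \<Rightarrow> bool" where
  "connected_graph V E \<longleftrightarrow> V \<noteq> {} \<and> (\<forall>u\<in>V. \<forall>v\<in>V. E\<^sup>*\<^sup>* u v)"

definition nbrs :: "(nat \<Rightarrow> nat \<Rightarrow> bool) \<Rightarrow> nat \<Rightarrow> nat set" where
  "nbrs E v = {u. E v u}"

definition max_degree :: "nat set \<Rightarrow> (nat \<Rightarrow> nat \<Rightarrow> bool) \<Rightarrow> nat" where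
  "max_degree V E = Max ((\<lambda>v. card (nbrs E v)) ` V)"

definition edges :: "(nat \<Rightarrow> nat \<Rightarrow> bool) \<Rightarrow> nat set set" where
  "edges E = {{u, v} | u v. E u v}"

text \<open>Generic pursuit game. State: cop configuration C (list, one entry per cop),
  robber vertex r, and a flag telling whether the cops move next (True) or the
  robber (False). cops_win is the least fixed point: the cops can force the
  winning condition in finitely many turns.\<close>

inductive cops_win ::
  "('p list \<Rightarrow> 'p list \<Rightarrow> bool) \<Rightarrow> ('p list \<Rightarrow> nat \<Rightarrow> nat \<Rightarrow> bool) \<Rightarrow>
   ('p list \<Rightarrow> nat \<Rightarrow> bool) \<Rightarrow> 'p list \<Rightarrow> nat \<Rightarrow> bool \<Rightarrow> bool"
  for cstep rstep won where
  done_win: "won C r \<Longrightarrow> cops_win cstep rstep won C r t"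
| cop_turn: "cstep C C' \<Longrightarrow> cops_win cstep rstep won C' r False \<Longrightarrow>
              cops_win cstep rstep won C r True"
| rob_turn: "(\<forall>r'. rstep C r r' \<longrightarrow> cops_win cstep rstep won C r' True) \<Longrightarrow>
              cops_win cstep rstep won C r False"

definition k_cops_win ::
  "'p set \<Rightarrow> ('p list \<Rightarrow> nat \<Rightarrow> bool) \<Rightarrow> ('p list \<Rightarrow> 'p list \<Rightarrow> bool) \<Rightarrow>
   ('p list \<Rightarrow> nat \<Rightarrow> nat \<Rightarrow> bool) \<Rightarrow> ('p list \<Rightarrow> nat \<Rightarrow> bool) \<Rightarrow> nat \<Rightarrow> bool" where
  "k_cops_win P init cstep rstep won k \<longleftrightarrow>
     (\<exists>C. length C = k \<and> set C \<subseteq> P \<and>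
        (\<forall>r. init C r \<longrightarrow> cops_win cstep rstep won C r True))"

definition vertex_cop_step :: "(nat \<Rightarrow> nat \<Rightarrow> bool) \<Rightarrow> nat list \<Rightarrow> nat list \<Rightarrow> bool" where
  "vertex_cop_step E C C' \<longleftrightarrow> length C' = length C \<and>
     (\<forall>i<length C. C' ! i = C ! i \<or> E (C ! i) (C' ! i))"

definition edge_cop_step :: "(nat \<Rightarrow> nat \<Rightarrow> bool) \<Rightarrow> nat set list \<Rightarrow> nat set list \<Rightarrow> bool" where
  "edge_cop_step E C C' \<longleftrightarrow> length C' = length C \<and>
     (\<forall>i<length C. C' ! i = C ! i \<or>
        (C' ! i \<in> edges E \<and> C' ! i \<noteq> C ! i \<and> C ! i \<inter> C' ! i \<noteq> {}))"

definition robber_move :: "(nat \<Rightarrow> nat \<Rightarrow> bool) \<Rightarrow> nat \<Rightarrow> nat \<Rightarrow> bool" where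
  "robber_move E r r' \<longleftrightarrow> r' = r \<or> E r r'"

definition cop_number :: "nat set \<Rightarrow> (nat \<Rightarrow> nat \<Rightarrow> bool) \<Rightarrow> nat" where
  "cop_number V E = (LEAST k. k_cops_win V (\<lambda>C r. r \<in> V) (vertex_cop_step E)
      (\<lambda>C r r'. robber_move E r r') (\<lambda>C r. r \<in> set C) k)"

definition cop_number_V :: "nat set \<Rightarrow> (nat \<Rightarrow> nat \<Rightarrow> bool) \<Rightarrow> nat" where
  "cop_number_V V E = (LEAST k. k_cops_win V (\<lambda>C r. r \<in> V) (vertex_cop_step E)
      (\<lambda>C r r'. robber_move E r r') (\<lambda>C r. nbrs E r \<subseteq> set C) k)"

definition cop_number_Vr :: "nat set \<Rightarrow> (nat \<Rightarrow> nat \<Rightarrow> bool) \<Rightarrow> nat" where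
  "cop_number_Vr V E = (LEAST k. k_cops_win V (\<lambda>C r. r \<in> V \<and> r \<notin> set C) (vertex_cop_step E)
      (\<lambda>C r r'. robber_move E r r' \<and> r' \<notin> set C) (\<lambda>C r. nbrs E r \<subseteq> set C) k)"

definition cop_number_E :: "nat set \<Rightarrow> (nat \<Rightarrow> nat \<Rightarrow> bool) \<Rightarrow> nat" where
  "cop_number_E V E = (LEAST k. k_cops_win (edges E) (\<lambda>C r. r \<in> V) (edge_cop_step E)
      (\<lambda>C r r'. robber_move E r r') (\<lambda>C r. {e \<in> edges E. r \<in> e} \<subseteq> set C) k)"

definition cop_number_Er :: "nat set \<Rightarrow> (nat \<Rightarrow> nat \<Rightarrow> bool) \<Rightarrow> nat" where
  "cop_number_Er V E = (LEAST k. k_cops_win (edges E) (\<lambda>C r. r \<in> V) (edge_cop_step E)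
      (\<lambda>C r r'. robber_move E r r' \<and> (r' \<noteq> r \<longrightarrow> {r, r'} \<notin> set C))
      (\<lambda>C r. {e \<in> edges E. r \<in> e} \<subseteq> set C) k)"

end

theory Submission
  imports Defs "HOL-Library.Nat_Bijection"
begin

text \<open>
  The graphs are butterfly networks thinned out to maximum degree 3: a vertex is a level together with a binary
  word, and an edge leads to an adjacent level and may change the one bit sitting between the two
  levels. To get from one vertex to another, a piece has to walk across every bit in which the two
  words differ.

  A robber running straight in one direction is never overtaken by a cop who has to fix a bit
  behind the robber's back. On a downward run, turning upwards while flipping bit t leaves the
  cops above with a difference below them, unless t was the lowest difference of one of them; each
  cop spoils only one turning point in this way, so k cops never surround a robber who has enough
  levels to run.

  In the classical game a cop on the robber's level copies the moves of the robber and removes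
  the difference at every bit the robber crosses. If all differences lie above the robber and below
  q, then the robber cannot reach level q without being caught. Meanwhile the second cop walks to
  the top, sweeps down and up again, and becomes such a guard with a smaller bound.
\<close>

section \<open>Comparison of pursuit games\<close>

text \<open>The cops of the second game shadow a winning play of the first: \<open>R\<close> is
  restored after every cop move, and a robber with fewer options only follows branches that are
  already won.\<close>

lemma cops_win_simulation:
  assumes "cops_win cstep rstep won C r t" and "R C D"
    and won: "\<And>C D r. R C D \<Longrightarrow> won C r \<Longrightarrow> won' D r"
    and cop: "\<And>C C' D. R C D \<Longrightarrow> cstep C C' \<Longrightarrow> \<exists>D'. cstep' D D' \<and> R C' D'"
    and rob: "\<And>C D r r'. R C D \<Longrightarrow> rstep' D r r' \<Longrightarrow> rstep C r r'"
  shows "cops_win cstep' rstep' won' D r t"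
  using assms(1,2)
proof (induction arbitrary: D rule: cops_win.induct)
  case (done_win C r t)
  then show ?case by (intro cops_win.done_win won)
next
  case (cop_turn C C' r)
  obtain D' where "cstep' D D'" "R C' D'" using cop[OF cop_turn.prems cop_turn.hyps(1)] by blast
  then show ?case using cop_turn.IH by (intro cops_win.cop_turn[of cstep' D D'])
next
  case (rob_turn C r)
  show ?case
  proof (rule cops_win.rob_turn, intro allI impI)
    fix r' assume "rstep' D r r'"
    then have "rstep C r r'" by (rule rob[OF rob_turn.prems])
    then show "cops_win cstep' rstep' won' D r' True" using rob_turn by blast
  qed
qed

text \<open>As \<open>cops_win\<close> is a least fixed point, a robber who can maintain an
  invariant that excludes \<open>won\<close> is never beaten.\<close>

lemma not_cops_winI:
  assumes "I C r t"
    and won: "\<And>C r t. I C r t \<Longrightarrow> \<not> won C r"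
    and cop: "\<And>C C' r. I C r True \<Longrightarrow> cstep C C' \<Longrightarrow> I C' r False"
    and rob: "\<And>C r. I C r False \<Longrightarrow> \<exists>r'. rstep C r r' \<and> I C r' True"
  shows "\<not> cops_win cstep rstep won C r t"
proof
  assume "cops_win cstep rstep won C r t"
  then show False using assms(1)
  proof (induction rule: cops_win.induct)
    case (done_win C r t)
    then show ?case using won by blast
  next
    case (cop_turn C C' r)
    then show ?case using cop by blast
  next
    case (rob_turn C r)
    from rob[OF rob_turn.prems] obtain r' where "rstep C r r'" "I C r' True" by blast
    then show ?case using rob_turn.IH by blast
  qed
qed

text \<open>Fewer starts or moves for the robber can only help the cops, who play as before. This
  leads from the unrestricted games to the restrictive ones.\<close>

lemma k_cops_win_restrict:
  assumes "k_cops_win P init cstep rstep won k"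
    and init: "\<And>C r. init' C r \<Longrightarrow> init C r"
    and rstep: "\<And>C r r'. rstep' C r r' \<Longrightarrow> rstep C r r'"
  shows "k_cops_win P init' cstep rstep' won k"
proof -
  obtain C where C: "length C = k" "set C \<subseteq> P"
    and win: "\<And>r. init C r \<Longrightarrow> cops_win cstep rstep won C r True"
    using assms(1) unfolding k_cops_win_def by blast
  have "cops_win cstep rstep' won C r True" if "init' C r" for r
    by (rule cops_win_simulation[where R = "(=)", OF win[OF init[OF that]]]) (auto intro: rstep)
  then show ?thesis unfolding k_cops_win_def using C by blast
qed

lemma k_cops_win_V_imp_Vr:
  assumes "k_cops_win V (\<lambda>C r. r \<in> V) (vertex_cop_step E)
      (\<lambda>C r r'. robber_move E r r') (\<lambda>C r. nbrs E r \<subseteq> set C) k"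
  shows "k_cops_win V (\<lambda>C r. r \<in> V \<and> r \<notin> set C) (vertex_cop_step E)
      (\<lambda>C r r'. robber_move E r r' \<and> r' \<notin> set C) (\<lambda>C r. nbrs E r \<subseteq> set C) k"
  by (rule k_cops_win_restrict[OF assms]) auto

lemma k_cops_win_E_imp_Er:
  assumes "k_cops_win P (\<lambda>C r. r \<in> V) (edge_cop_step E)
      (\<lambda>C r r'. robber_move E r r') (\<lambda>C r. {e \<in> edges E. r \<in> e} \<subseteq> set C) k"
  shows "k_cops_win P (\<lambda>C r. r \<in> V) (edge_cop_step E)
      (\<lambda>C r r'. robber_move E r r' \<and> (r' \<noteq> r \<longrightarrow> {r, r'} \<notin> set C))
      (\<lambda>C r. {e \<in> edges E. r \<in> e} \<subseteq> set C) k"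
  by (rule k_cops_win_restrict[OF assms]) auto

text \<open>An edge cop is simulated by two vertex cops at the ends of its edge.\<close>

definition endpoints :: "(nat \<Rightarrow> nat \<Rightarrow> bool) \<Rightarrow> nat set list \<Rightarrow> nat list \<Rightarrow> bool" where
  "endpoints E C D \<longleftrightarrow> (\<exists>A B. D = A @ B \<and> length A = length C \<and> length B = length C \<and>
     (\<forall>i<length C. C ! i = {A ! i, B ! i} \<and> E (A ! i) (B ! i)))"

text \<open>If the edge changes, the old and the new one share a vertex \<open>w\<close>. The cop on
  \<open>w\<close> goes to the new end and its partner takes over \<open>w\<close>; keeping the
  first one on \<open>w\<close> could ask two steps of the partner.\<close>

lemma endpoints_cop_step:
  assumes "simple_graph V E" and "endpoints E C D" and step: "edge_cop_step E C C'"
  shows "\<exists>D'. vertex_cop_step E D D' \<and> endpoints E C' D'"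
proof -
  obtain A B where D: "D = A @ B" and len: "length A = length C" "length B = length C"
    and AB: "\<And>i. i < length C \<Longrightarrow> C ! i = {A ! i, B ! i} \<and> E (A ! i) (B ! i)"
    using assms(2) unfolding endpoints_def by blast
  have sym: "E u v \<Longrightarrow> E v u" for u v
    using assms(1) by (auto simp: simple_graph_def)
  have len': "length C' = length C"
    using step by (simp add: edge_cop_step_def)
  have "\<exists>a b. C' ! i = {a, b} \<and> E a b \<and> (a = A ! i \<or> E (A ! i) a) \<and> (b = B ! i \<or> E (B ! i) b)"
    if i: "i < length C" for i
  proof (cases "C' ! i = C ! i")
    case True
    then show ?thesis using AB[OF i] by blast
  next
    case False
    then have "C' ! i \<in> edges E" and int: "C ! i \<inter> C' ! i \<noteq> {}"
      using step i unfolding edge_cop_step_def by blast+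
    then obtain x y where xy: "C' ! i = {x, y}" "E x y" unfolding edges_def by blast
    with int obtain w where w: "w \<in> C ! i" "w \<in> {x, y}" by auto
    then obtain z where "C' ! i = {w, z}" "E w z" using xy sym by blast
    moreover have "w = A ! i \<or> w = B ! i" "E (A ! i) (B ! i)" using w(1) AB[OF i] by auto
    ultimately have "C' ! i = {z, A ! i} \<and> E z (A ! i) \<and> E (A ! i) z \<and> E (B ! i) (A ! i) \<or>
        C' ! i = {B ! i, z} \<and> E (B ! i) z \<and> E (A ! i) (B ! i)"
      using sym by (auto simp: insert_commute)
    then show ?thesis by blast
  qed
  then obtain a b where ab: "\<And>i. i < length C \<Longrightarrow> C' ! i = {a i, b i} \<and> E (a i) (b i) \<and>
      (a i = A ! i \<or> E (A ! i) (a i)) \<and> (b i = B ! i \<or> E (B ! i) (b i))"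
    by metis
  let ?D' = "map a [0..<length C] @ map b [0..<length C]"
  have "vertex_cop_step E D ?D'"
    unfolding vertex_cop_step_def D using ab len by (auto simp: nth_append)
  moreover have "endpoints E C' ?D'"
    unfolding endpoints_def
    by (intro exI[of _ "map a [0..<length C]"] exI[of _ "map b [0..<length C]"]) (use ab len' in simp)
  ultimately show ?thesis by blast
qed

text \<open>The vertex cops occupy exactly the ends of the occupied edges. So a robber who avoids
  them never uses an occupied edge, and once all edges at \<open>r\<close> are occupied, so are all
  its neighbours.\<close>

lemma k_cops_win_Er_imp_Vr:
  assumes G: "simple_graph V E"
    and win: "k_cops_win (edges E) (\<lambda>C r. r \<in> V) (edge_cop_step E)
      (\<lambda>C r r'. robber_move E r r' \<and> (r' \<noteq> r \<longrightarrow> {r, r'} \<notin> set C))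
      (\<lambda>C r. {e \<in> edges E. r \<in> e} \<subseteq> set C) k"
  shows "k_cops_win V (\<lambda>C r. r \<in> V \<and> r \<notin> set C) (vertex_cop_step E)
      (\<lambda>C r r'. robber_move E r r' \<and> r' \<notin> set C) (\<lambda>C r. nbrs E r \<subseteq> set C) (2 * k)"
proof -
  obtain C where C: "length C = k" "set C \<subseteq> edges E"
    and Cwin: "\<And>r. r \<in> V \<Longrightarrow> cops_win (edge_cop_step E)
      (\<lambda>C r r'. robber_move E r r' \<and> (r' \<noteq> r \<longrightarrow> {r, r'} \<notin> set C))
      (\<lambda>C r. {e \<in> edges E. r \<in> e} \<subseteq> set C) C r True"
    using win unfolding k_cops_win_def by blast
  have "\<exists>a b. C ! i = {a, b} \<and> E a b" if "i < length C" for i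
  proof -
    have "C ! i \<in> edges E" using C(2) that by (auto simp: subset_eq)
    then show ?thesis unfolding edges_def by blast
  qed
  then obtain a b where ab: "\<And>i. i < length C \<Longrightarrow> C ! i = {a i, b i} \<and> E (a i) (b i)"
    by metis
  let ?D = "map a [0..<length C] @ map b [0..<length C]"
  have D: "endpoints E C ?D"
    unfolding endpoints_def
    by (intro exI[of _ "map a [0..<length C]"] exI[of _ "map b [0..<length C]"]) (use ab in simp)
  have mem: "x \<in> set D \<longleftrightarrow> (\<exists>e\<in>set C. x \<in> e)" if "endpoints E C D" for C D x
  proof -
    obtain A B where AB: "D = A @ B" "length A = length C" "length B = length C"
      "\<And>i. i < length C \<Longrightarrow> C ! i = {A ! i, B ! i}"
      using \<open>endpoints E C D\<close> unfolding endpoints_def by blast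
    have "x \<in> set D \<longleftrightarrow> (\<exists>i<length C. x = A ! i \<or> x = B ! i)"
      using AB(1-3) by (auto simp: in_set_conv_nth)
    also have "\<dots> \<longleftrightarrow> (\<exists>i<length C. x \<in> C ! i)" using AB(4) by auto
    also have "\<dots> \<longleftrightarrow> (\<exists>e\<in>set C. x \<in> e)" by (metis in_set_conv_nth)
    finally show ?thesis .
  qed
  have "cops_win (vertex_cop_step E) (\<lambda>C r r'. robber_move E r r' \<and> r' \<notin> set C)
      (\<lambda>C r. nbrs E r \<subseteq> set C) ?D r True" if "r \<in> V" for r
  proof (rule cops_win_simulation[where R = "endpoints E", OF Cwin[OF that] D])
    show "nbrs E r \<subseteq> set D" if "endpoints E C D" "{e \<in> edges E. r \<in> e} \<subseteq> set C" for C D r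
    proof
      fix u assume "u \<in> nbrs E r"
      then have "{r, u} \<in> {e \<in> edges E. r \<in> e}" unfolding nbrs_def edges_def by blast
      then have "{r, u} \<in> set C" using that(2) by blast
      then show "u \<in> set D" using mem[OF that(1)] by blast
    qed
    show "\<exists>D'. vertex_cop_step E D D' \<and> endpoints E C' D'"
      if "endpoints E C D" "edge_cop_step E C C'" for C C' D
      using endpoints_cop_step[OF G that] .
    show "robber_move E r r' \<and> (r' \<noteq> r \<longrightarrow> {r, r'} \<notin> set C)"
      if "endpoints E C D" "robber_move E r r' \<and> r' \<notin> set D" for C D r r'
      using mem[OF that(1)] that(2) by blast
  qed
  moreover have "set ?D \<subseteq> V"
  proof
    fix x assume "x \<in> set ?D"
    then obtain i where "i < length C" "x = a i \<or> x = b i" by auto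
    then show "x \<in> V" using ab[of i] G unfolding simple_graph_def by blast
  qed
  moreover have "length ?D = 2 * k" using C by simp
  ultimately show ?thesis unfolding k_cops_win_def by blast
qed

lemma less_Least:
  assumes "P (m :: nat)" and "\<And>k. P k \<Longrightarrow> N < k"
  shows "N < (LEAST k. P k)"
  by (rule assms(2)) (rule LeastI[of P, OF assms(1)])

text \<open>Every game reduces to the restrictive vertex game, the edge games at the price of
  doubling the cops; hence the bound \<open>2 * N\<close> in \<open>evade\<close>.\<close>

lemma cop_numbers_large:
  assumes G: "simple_graph V E"
    and evade: "\<And>k. k \<le> 2 * N \<Longrightarrow>
      \<not> k_cops_win V (\<lambda>C r. r \<in> V \<and> r \<notin> set C) (vertex_cop_step E)
      (\<lambda>C r r'. robber_move E r r' \<and> r' \<notin> set C) (\<lambda>C r. nbrs E r \<subseteq> set C) k"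
  shows "N < cop_number_V V E" "N < cop_number_Vr V E" "N < cop_number_E V E"
    "N < cop_number_Er V E"
proof -
  have "finite V" using G by (simp add: simple_graph_def)
  then obtain vs where vs: "set vs = V" using finite_list by blast
  have "edges E \<subseteq> Pow V" using G by (auto simp: simple_graph_def edges_def)
  then obtain es where es: "set es = edges E"
    using \<open>finite V\<close> by (meson finite_Pow_iff finite_list finite_subset)
  have nb: "nbrs E r \<subseteq> set vs" for r using G vs by (auto simp: nbrs_def simple_graph_def)
  \<comment> \<open>A cop on every vertex, and below a cop on every edge, surrounds the robber at
    once, so each cop number is the minimum of a nonempty set.\<close>
  have V: "k_cops_win V (\<lambda>C r. r \<in> V) (vertex_cop_step E)
      (\<lambda>C r r'. robber_move E r r') (\<lambda>C r. nbrs E r \<subseteq> set C) (length vs)"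
    unfolding k_cops_win_def using vs nb by (intro exI[of _ vs]) (auto intro: cops_win.done_win)
  have E: "k_cops_win (edges E) (\<lambda>C r. r \<in> V) (edge_cop_step E)
      (\<lambda>C r r'. robber_move E r r') (\<lambda>C r. {e \<in> edges E. r \<in> e} \<subseteq> set C) (length es)"
    unfolding k_cops_win_def using es by (intro exI[of _ es]) (auto intro: cops_win.done_win)
  have Vr_le: "k_cops_win V (\<lambda>C r. r \<in> V \<and> r \<notin> set C) (vertex_cop_step E)
      (\<lambda>C r r'. robber_move E r r' \<and> r' \<notin> set C) (\<lambda>C r. nbrs E r \<subseteq> set C) k
      \<Longrightarrow> 2 * N < k" for k
    using evade not_le by blast
  show "N < cop_number_V V E"
    unfolding cop_number_V_def
    by (rule less_Least, rule V) (drule k_cops_win_V_imp_Vr, drule Vr_le, simp)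
  show "N < cop_number_Vr V E"
    unfolding cop_number_Vr_def
    by (rule less_Least, rule k_cops_win_V_imp_Vr[OF V]) (drule Vr_le, simp)
  show "N < cop_number_Er V E"
    unfolding cop_number_Er_def
    by (rule less_Least, rule k_cops_win_E_imp_Er[OF E])
      (drule k_cops_win_Er_imp_Vr[OF G], drule Vr_le, simp)
  show "N < cop_number_E V E"
    unfolding cop_number_E_def
    by (rule less_Least, rule E)
      (drule k_cops_win_E_imp_Er, drule k_cops_win_Er_imp_Vr[OF G], drule Vr_le, simp)
qed

section \<open>Butterfly graphs\<close>

text \<open>
  Only even bits exist, so the steps between an odd level and the next one are plain edges; this
  splits the vertices of the usual 4-regular butterfly and makes the maximum degree 3. The level
  and word functions are parameters because the graph is also used upside down.
\<close>

locale butterfly =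
  fixes L :: nat and V :: "nat set" and E :: "nat \<Rightarrow> nat \<Rightarrow> bool"
    and lv :: "nat \<Rightarrow> nat" and wd :: "nat \<Rightarrow> nat set"
  assumes odd_L: "odd L"
    and E_iff: "E u v \<longleftrightarrow> u \<in> V \<and> v \<in> V \<and>
      (lv v = Suc (lv u) \<and> (\<forall>i. i \<noteq> lv u \<longrightarrow> (i \<in> wd v \<longleftrightarrow> i \<in> wd u)) \<or>
       lv u = Suc (lv v) \<and> (\<forall>i. i \<noteq> lv v \<longrightarrow> (i \<in> wd v \<longleftrightarrow> i \<in> wd u)))"
    and lv_le: "v \<in> V \<Longrightarrow> lv v \<le> L"
    and wdD: "v \<in> V \<Longrightarrow> i \<in> wd v \<Longrightarrow> even i \<and> i < L"
    and vertex_eqI: "u \<in> V \<Longrightarrow> v \<in> V \<Longrightarrow> lv u = lv v \<Longrightarrow> wd u = wd v \<Longrightarrow> u = v"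
    and vertex_ex: "s \<le> L \<Longrightarrow> (\<And>i. i \<in> X \<Longrightarrow> even i \<and> i < L) \<Longrightarrow> \<exists>v\<in>V. lv v = s \<and> wd v = X"
begin

section \<open>Steps and differing bits\<close>

definition differ :: "nat \<Rightarrow> nat \<Rightarrow> nat \<Rightarrow> bool" where
  "differ u v i \<longleftrightarrow> (i \<in> wd u) \<noteq> (i \<in> wd v)"

lemma differD: "u \<in> V \<Longrightarrow> v \<in> V \<Longrightarrow> differ u v i \<Longrightarrow> even i \<and> i < L"
  using wdD by (auto simp: differ_def)

lemma eq_if_no_differ: "u \<in> V \<Longrightarrow> v \<in> V \<Longrightarrow> lv u = lv v \<Longrightarrow> (\<And>i. \<not> differ u v i) \<Longrightarrow> u = v"
  by (rule vertex_eqI) (auto simp: differ_def)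

lemma E_sym: "E u v \<Longrightarrow> E v u"
  unfolding E_iff by auto

lemma E_in_V: "E u v \<Longrightarrow> u \<in> V \<and> v \<in> V"
  by (simp add: E_iff)

lemma E_lv: "E u v \<Longrightarrow> lv v = Suc (lv u) \<or> lv u = Suc (lv v)"
  unfolding E_iff by auto

lemma step_lv:
  assumes "v = u \<or> E u v" shows "lv v \<le> Suc (lv u)" "lv u \<le> Suc (lv v)"
  using assms E_lv by (metis Suc_n_not_le_n le_SucI nle_le)+

text \<open>Bit \<open>i\<close> sits between levels \<open>i\<close> and \<open>Suc i\<close>, so
  the second hypothesis says that the step does not cross it.\<close>

lemma step_wd:
  assumes "v = u \<or> E u v" and "i < lv u \<and> i < lv v \<or> lv u \<le> i \<and> lv v \<le> i"
  shows "i \<in> wd v \<longleftrightarrow> i \<in> wd u"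
  using assms unfolding E_iff by (metis less_Suc_eq_le lessI not_le)

lemma step_differ:
  assumes "v = u \<or> E u v" and "i < lv u \<and> i < lv v \<or> lv u \<le> i \<and> lv v \<le> i"
  shows "differ v w i \<longleftrightarrow> differ u w i" "differ w v i \<longleftrightarrow> differ w u i"
  using step_wd[OF assms] by (auto simp: differ_def)

lemma up_ex:
  assumes "u \<in> V" "lv u < L" "even (lv u) \<or> \<not> b"
  shows "\<exists>v. E u v \<and> lv v = Suc (lv u) \<and> wd v = {i. if i = lv u then b else i \<in> wd u}"
proof -
  have "\<exists>v\<in>V. lv v = Suc (lv u) \<and> wd v = {i. if i = lv u then b else i \<in> wd u}"
    by (rule vertex_ex) (use assms wdD in \<open>auto split: if_splits\<close>)
  then show ?thesis using assms(1) by (auto simp: E_iff)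
qed

lemma down_ex:
  assumes "u \<in> V" "lv u = Suc s" "even s \<or> \<not> b"
  shows "\<exists>v. E u v \<and> lv v = s \<and> wd v = {i. if i = s then b else i \<in> wd u}"
proof -
  have "\<exists>v\<in>V. lv v = s \<and> wd v = {i. if i = s then b else i \<in> wd u}"
    by (rule vertex_ex) (use assms wdD lv_le[of u] in \<open>auto split: if_splits\<close>)
  then show ?thesis using assms(1,2) by (auto simp: E_iff)
qed

text \<open>The bit crossed is copied from \<open>w\<close>. This is always a legal move, since at
  an odd level the word of \<open>w\<close> has no bit to copy.\<close>

lemma up_towards:
  assumes "u \<in> V" "w \<in> V" "lv u < L"
  obtains v where "E u v" "lv v = Suc (lv u)" "\<And>i. differ v w i \<longleftrightarrow> differ u w i \<and> i \<noteq> lv u"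
  using up_ex[of u "lv u \<in> wd w"] assms wdD by (force simp: differ_def)

lemma down_towards:
  assumes "u \<in> V" "w \<in> V" "lv u = Suc s"
  obtains v where "E u v" "lv v = s" "\<And>i. differ v w i \<longleftrightarrow> differ u w i \<and> i \<noteq> s"
  using down_ex[of u s "s \<in> wd w"] assms wdD by (force simp: differ_def)

lemma straight_up:
  assumes "u \<in> V" "lv u < L"
  obtains v where "E u v" "lv v = Suc (lv u)" "wd v = wd u"
proof -
  obtain v where "E u v" "lv v = Suc (lv u)" "\<And>i. \<not> differ v u i"
    using up_towards[OF assms(1,1,2)] by (metis differ_def)
  then show thesis using that by (auto simp: differ_def)
qed

lemma straight_down:
  assumes "u \<in> V" "lv u = Suc s"
  obtains v where "E u v" "lv v = s" "wd v = wd u"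
proof -
  obtain v where "E u v" "lv v = s" "\<And>i. \<not> differ v u i"
    using down_towards[OF assms(1,1,2)] by (metis differ_def)
  then show thesis using that by (auto simp: differ_def)
qed

lemma cross_up:
  assumes "u \<in> V" "lv u < L" "even (lv u)"
  obtains v where "E u v" "lv v = Suc (lv u)" "\<And>i. i \<in> wd v \<longleftrightarrow> (i \<in> wd u) \<noteq> (i = lv u)"
  using up_ex[OF assms(1,2), of "lv u \<notin> wd u"] assms(3) by auto

lemma cross_down:
  assumes "u \<in> V" "lv u = Suc s" "even s"
  obtains v where "E u v" "lv v = s" "\<And>i. i \<in> wd v \<longleftrightarrow> (i \<in> wd u) \<noteq> (i = s)"
  using down_ex[OF assms(1,2), of "s \<notin> wd u"] assms(3) by auto

section \<open>Evading the surrounding cops\<close>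

text \<open>The invariant of a downward run: a cop below could stand straight in the robber's way
  only after going back up past the robber's level to repair bit \<open>i\<close>.\<close>

definition clear_below :: "nat list \<Rightarrow> nat \<Rightarrow> bool" where
  "clear_below C r \<longleftrightarrow> r \<in> V \<and> set C \<subseteq> V \<and> (\<forall>c\<in>set C. lv c < lv r \<longrightarrow> (\<exists>i\<ge>lv r. differ c r i))"

text \<open>The counterpart for an upward run: the repair would have to be made below the
  robber.\<close>

definition clear_above :: "nat list \<Rightarrow> nat \<Rightarrow> bool" where
  "clear_above C r \<longleftrightarrow> r \<in> V \<and> set C \<subseteq> V \<and> (\<forall>c\<in>set C. lv r < lv c \<longrightarrow> (\<exists>i<lv r. differ c r i))"

text \<open>A spent cop can no longer spoil a turning point of the present downward run.\<close>

definition spent :: "nat \<Rightarrow> nat \<Rightarrow> bool" where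
  "spent r c \<longleftrightarrow> lv r \<le> lv c \<and> (\<forall>i<lv r. \<not> differ c r i) \<and> (lv c = lv r \<or> \<not> differ c r (lv r))"

text \<open>Indices instead of vertices, so that cops sharing a vertex count separately and each cop
  can be followed through a step.\<close>

definition unspent :: "nat list \<Rightarrow> nat \<Rightarrow> nat set" where
  "unspent C r = {j. j < length C \<and> \<not> spent r (C ! j)}"

text \<open>Above level \<open>2 * k + 2\<close> the robber only runs. From there on, each cop not
  yet spent may cost two levels, as turns happen at even levels only, and a reserve of two keeps the
  next vertex above level 0.\<close>

definition running :: "nat \<Rightarrow> nat list \<Rightarrow> nat \<Rightarrow> bool" where
  "running k C r \<longleftrightarrow> length C = k \<and> clear_below C r \<and>
     (2 * k + 2 < lv r \<or> 2 * card (unspent C r) + 2 \<le> lv r)"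

lemma card_unspent_le: "card (unspent C r) \<le> length C"
  by (rule order_trans[OF card_mono[of "{..<length C}"]]) (auto simp: unspent_def)

lemma cop_stepD:
  assumes "vertex_cop_step E C C'" "c' \<in> set C'"
  obtains c where "c \<in> set C" "c' = c \<or> E c c'"
  using assms unfolding vertex_cop_step_def by (metis in_set_conv_nth)

lemma cop_step_in_V:
  assumes "vertex_cop_step E C C'" "set C \<subseteq> V"
  shows "set C' \<subseteq> V"
  using cop_stepD[OF assms(1)] assms(2) E_in_V by (metis subset_eq)

lemma straight_below_free:
  assumes "clear_below C r" "lv c < lv r" "wd c = wd r"
  shows "c \<notin> set C"
  using assms by (auto simp: clear_below_def differ_def)

lemma not_surrounded_below:
  assumes "clear_below C r" "r' \<in> V" "0 < lv r'" "lv r' \<le> lv r" "wd r' = wd r"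
  shows "\<not> nbrs E r' \<subseteq> set C"
proof -
  obtain s where s: "lv r' = Suc s" using assms(3) gr0_conv_Suc by blast
  obtain v where "E r' v" "lv v = s" "wd v = wd r'"
    using straight_down[OF assms(2) s] .
  then have "v \<notin> set C" "v \<in> nbrs E r'"
    using straight_below_free[OF assms(1), of v] s assms(4,5) by (auto simp: nbrs_def)
  then show ?thesis by blast
qed

text \<open>A cop below the robber after the step was below before it, so its step stays under bit
  \<open>i\<close>, while the robber's straight step changes no bit.\<close>

lemma clear_below_step:
  assumes "clear_below C r" "E r r'" "lv r = Suc (lv r')" "wd r' = wd r" "vertex_cop_step E C C'"
  shows "clear_below C' r'"
  unfolding clear_below_def
proof (intro conjI ballI impI)
  show "r' \<in> V" using assms(2) E_in_V by blast
  show "set C' \<subseteq> V" using assms(1,5) cop_step_in_V by (auto simp: clear_below_def)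
  fix c' assume c': "c' \<in> set C'" "lv c' < lv r'"
  obtain c where c: "c \<in> set C" "c' = c \<or> E c c'" using cop_stepD[OF assms(5) c'(1)] .
  have "lv c < lv r" using step_lv[OF c(2)] c'(2) assms(3) by linarith
  then obtain i where i: "i \<ge> lv r" "differ c r i"
    using assms(1) c(1) by (auto simp: clear_below_def)
  have "differ c' r i"
    using step_differ[OF c(2), of i r] i c'(2) \<open>lv c < lv r\<close> assms(3) by auto
  then show "\<exists>i\<ge>lv r'. differ c' r' i"
    using i assms(3,4) by (intro exI[of _ i]) (auto simp: differ_def)
qed

text \<open>The cop ends at or above the new level and so crosses no bit below it. Bit
  \<open>lv r'\<close> is crossed only by stepping down to level \<open>lv r'\<close> itself, which
  is the exceptional case in \<open>spent\<close>.\<close>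

lemma spent_step:
  assumes "spent r c \<or> (lv r < lv c \<and> (\<forall>i<lv r. \<not> differ c r i))"
    and "lv r = Suc (lv r')" "wd r' = wd r" and c: "c' = c \<or> E c c'"
  shows "spent r' c'"
  unfolding spent_def
proof (intro conjI allI impI)
  have le: "lv r \<le> lv c" and no: "\<And>i. i < lv r \<Longrightarrow> \<not> differ c r i"
    using assms(1) by (auto simp: spent_def)
  show le': "lv r' \<le> lv c'" using le step_lv[OF c] assms(2) by linarith
  show "\<not> differ c' r' i" if "i < lv r'" for i
    using step_differ[OF c, of i r] no[of i] that le le' assms(2,3) by (auto simp: differ_def)
  show "lv c' = lv r' \<or> \<not> differ c' r' (lv r')"
  proof (cases "lv c' = lv r'")
    case False
    then have "differ c' r (lv r') \<longleftrightarrow> differ c r (lv r')"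
      using le le' assms(2) by (intro step_differ(1)[OF c]) linarith
    then show ?thesis using no[of "lv r'"] assms(2,3) by (simp add: differ_def)
  qed simp
qed

lemma unspent_step:
  assumes "lv r = Suc (lv r')" "wd r' = wd r" "vertex_cop_step E C C'"
  shows "unspent C' r' \<subseteq> {j \<in> unspent C r. \<not> (lv r < lv (C ! j) \<and> (\<forall>i<lv r. \<not> differ (C ! j) r i))}"
  using spent_step[OF _ assms(1,2)] assms(3)
  unfolding unspent_def vertex_cop_step_def by fastforce

text \<open>Crossing bit \<open>lv r\<close> toggles the difference there and nowhere else, so
  \<open>free\<close> leaves every cop above with a difference at or below \<open>lv r\<close>. A
  cop that stays above has no chance to cross that bit.\<close>

lemma clear_above_turn:
  assumes "clear_below C r" "even (lv r)" "E r r'" "lv r' = Suc (lv r)"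
    and r': "\<And>i. i \<in> wd r' \<longleftrightarrow> (i \<in> wd r) \<noteq> (i = lv r)"
    and free: "\<And>c. c \<in> set C \<Longrightarrow> lv r < lv c \<Longrightarrow> \<exists>i\<le>lv r. differ c r i \<noteq> (i = lv r)"
    and step: "vertex_cop_step E C C'"
  shows "clear_above C' r'"
  unfolding clear_above_def
proof (intro conjI ballI impI)
  show "r' \<in> V" using assms(3) E_in_V by blast
  show "set C' \<subseteq> V" using assms(1) step cop_step_in_V by (auto simp: clear_below_def)
  fix c' assume c': "c' \<in> set C'" "lv r' < lv c'"
  obtain c where c: "c \<in> set C" "c' = c \<or> E c c'" using cop_stepD[OF step c'(1)] .
  have "lv r < lv c" using step_lv[OF c(2)] c'(2) assms(4) by linarith
  then obtain i where i: "i \<le> lv r" "differ c r i \<noteq> (i = lv r)" using free c(1) by blast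
  have "differ c r' i" using i r' by (auto simp: differ_def)
  then have "differ c' r' i"
    using step_differ[OF c(2), of i r'] i c'(2) \<open>lv r < lv c\<close> assms(4) by auto
  then show "\<exists>i<lv r'. differ c' r' i" using i assms(4) by (intro exI[of _ i]) auto
qed

lemma running_step:
  assumes run: "running k C r" and L: "4 * k + 6 \<le> L"
  shows "\<exists>r'. E r r' \<and> r' \<notin> set C \<and> \<not> nbrs E r' \<subseteq> set C \<and>
    (\<forall>C'. vertex_cop_step E C C' \<longrightarrow>
       running k C' r' \<or> length C' = k \<and> clear_above C' r' \<and> 2 * k + 2 < L - lv r')"
proof -
  have len: "length C = k" and clear: "clear_below C r" using run by (auto simp: running_def)
  then have rV: "r \<in> V" by (simp add: clear_below_def)
  have pos: "2 \<le> lv r" using run by (auto simp: running_def)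
  show ?thesis
  \<comment> \<open>The robber turns once it is low enough for a long run upwards, the level has a
    bit above it, and no cop spoils the turn; otherwise it goes straight down.\<close>
  proof (cases "lv r \<le> 2 * k + 2 \<and> even (lv r) \<and>
      (\<forall>c\<in>set C. lv r < lv c \<longrightarrow> (\<exists>i\<le>lv r. differ c r i \<noteq> (i = lv r)))")
    case True
    then obtain r' where r': "E r r'" "lv r' = Suc (lv r)"
        "\<And>i. i \<in> wd r' \<longleftrightarrow> (i \<in> wd r) \<noteq> (i = lv r)"
      using cross_up[OF rV] L by auto
    have "clear_above C' r'" if "vertex_cop_step E C C'" for C'
      using clear_above_turn[OF clear _ r' _ that] True by blast
    \<comment> \<open>A cop above with the word of \<open>r'\<close> would differ from
      \<open>r\<close> in bit \<open>lv r\<close> only, which the case excludes. This covers both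
      \<open>r'\<close> and the vertex straight above it.\<close>
    moreover have free: "c \<notin> set C" if "lv r < lv c" "wd c = wd r'" for c
      using True that r'(3) by (auto simp: differ_def)
    then have "r' \<notin> set C" using r'(2) by simp
    moreover have "\<not> nbrs E r' \<subseteq> set C"
    proof -
      have "lv r' < L" using True L r'(2) by linarith
      then obtain v where "E r' v" "lv v = Suc (lv r')" "wd v = wd r'"
        using straight_up[of r'] E_in_V[OF r'(1)] by blast
      then have "v \<notin> set C" "v \<in> nbrs E r'" using free[of v] r'(2) by (auto simp: nbrs_def)
      then show ?thesis by blast
    qed
    ultimately show ?thesis
      using r' True L len by (intro exI[of _ r']) (auto simp: vertex_cop_step_def)
  next
    case False
    obtain r' where r': "E r r'" "lv r = Suc (lv r')" "wd r' = wd r"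
      using straight_down[OF rV, of "lv r - 1"] pos
      by (metis One_nat_def Suc_pred le_trans less_eq_Suc_le one_le_numeral)
    have "running k C' r'" if C': "vertex_cop_step E C C'" for C'
    proof -
      let ?U = "{j \<in> unspent C r. \<not> (lv r < lv (C ! j) \<and> (\<forall>i<lv r. \<not> differ (C ! j) r i))}"
      have fin: "finite (unspent C r)" by (simp add: unspent_def)
      have sub: "unspent C' r' \<subseteq> ?U" using unspent_step[OF r'(2,3) C'] .
      have le: "card (unspent C' r') \<le> card (unspent C r)"
        by (rule card_mono[OF fin]) (use sub in blast)
      have lenC': "length C' = k" using C' len by (simp add: vertex_cop_step_def)
      have "2 * k + 2 < lv r' \<or> 2 * card (unspent C' r') + 2 \<le> lv r'"
      proof (cases "2 * k + 2 < lv r")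
        case True
        then show ?thesis using card_unspent_le[of C' r'] lenC' r'(2) by linarith
      next
        case small: False
        then have fuel: "2 * card (unspent C r) + 2 \<le> lv r" using run by (auto simp: running_def)
        show ?thesis
        proof (cases "even (lv r)")
          case True
          \<comment> \<open>The spoiling cop is unspent now, as it is strictly above and differs at
            \<open>lv r\<close>, and spent after the step. This frees two levels, one for this step
            and one for the odd level that follows.\<close>
          then obtain c where c: "c \<in> set C" "lv r < lv c" "\<And>i. i \<le> lv r \<Longrightarrow> differ c r i \<longleftrightarrow> i = lv r"
            using False small by auto
          then obtain j where j: "j < length C" "c = C ! j" by (auto simp: in_set_conv_nth)
          then have "j \<in> unspent C r" using c by (auto simp: unspent_def spent_def)
          moreover have "j \<notin> ?U" using c j by auto
          ultimately have "unspent C' r' \<subset> unspent C r" using sub by blast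
          then have "card (unspent C' r') < card (unspent C r)" by (rule psubset_card_mono[OF fin])
          then show ?thesis using fuel r'(2) by linarith
        next
          case odd: False
          \<comment> \<open>The even number \<open>2 * card (unspent C r) + 2\<close> cannot equal
            an odd level, so one level is to spare.\<close>
          then obtain m where "lv r = 2 * m + 1" by (rule oddE)
          then have "2 * card (unspent C r) + 3 \<le> lv r" using fuel by presburger
          then show ?thesis using le r'(2) by linarith
        qed
      qed
      then show ?thesis
        using clear_below_step[OF clear r'(1,2,3) C'] lenC' by (simp add: running_def)
    qed
    moreover have "r' \<notin> set C"
      using straight_below_free[OF clear] r'(2,3) by simp
    moreover have "\<not> nbrs E r' \<subseteq> set C"
      using not_surrounded_below[OF clear _ _ _ r'(3)] E_in_V[OF r'(1)] pos r'(2) by simp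
    ultimately show ?thesis using r'(1) by blast
  qed
qed

section \<open>The butterfly upside down\<close>

definition reflected_lv :: "nat \<Rightarrow> nat" where
  "reflected_lv v = L - lv v"

text \<open>Reflection moves the bit between levels \<open>i\<close> and \<open>Suc i\<close> to the
  place between \<open>L - Suc i\<close> and \<open>L - i\<close>; hence the index
  \<open>L - Suc i\<close>.\<close>

definition reflected_wd :: "nat \<Rightarrow> nat set" where
  "reflected_wd v = {i. i < L \<and> L - Suc i \<in> wd v}"

text \<open>This makes upward runs instances of the results on downward runs. As \<open>L\<close> is
  odd, \<open>L - Suc i\<close> has the parity of \<open>i\<close>, so even bits stay even.\<close>

lemma reflection: "butterfly L V E reflected_lv reflected_wd"
proof
  show "odd L" by (rule odd_L)
  have bits: "(\<forall>i. i \<noteq> L - Suc s \<longrightarrow> (i \<in> reflected_wd v \<longleftrightarrow> i \<in> reflected_wd u)) \<longleftrightarrow>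
      (\<forall>i. i \<noteq> s \<longrightarrow> (i \<in> wd v \<longleftrightarrow> i \<in> wd u))" (is "?l \<longleftrightarrow> ?r")
    if uv: "u \<in> V" "v \<in> V" and s: "s < L" for u v s
  proof
    assume l: ?l
    show ?r
    proof (intro allI impI)
      fix i assume "i \<noteq> s"
      show "i \<in> wd v \<longleftrightarrow> i \<in> wd u"
      proof (cases "i < L")
        case True
        then have "L - Suc i \<noteq> L - Suc s" "L - Suc i < L" "L - Suc (L - Suc i) = i"
          using \<open>i \<noteq> s\<close> s by linarith+
        then show ?thesis using l by (auto simp: reflected_wd_def)
      next
        case False
        then show ?thesis using wdD uv by blast
      qed
    qed
  next
    assume r: ?r
    show ?l
    proof (intro allI impI)
      fix i assume "i \<noteq> L - Suc s"
      then have "i < L \<Longrightarrow> L - Suc i \<noteq> s" using s by linarith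
      then show "i \<in> reflected_wd v \<longleftrightarrow> i \<in> reflected_wd u"
        using r by (auto simp: reflected_wd_def)
    qed
  qed
  show "E u v \<longleftrightarrow> u \<in> V \<and> v \<in> V \<and>
      (reflected_lv v = Suc (reflected_lv u) \<and> (\<forall>i. i \<noteq> reflected_lv u \<longrightarrow> (i \<in> reflected_wd v \<longleftrightarrow> i \<in> reflected_wd u)) \<or>
       reflected_lv u = Suc (reflected_lv v) \<and> (\<forall>i. i \<noteq> reflected_lv v \<longrightarrow> (i \<in> reflected_wd v \<longleftrightarrow> i \<in> reflected_wd u)))" for u v
  proof (cases "u \<in> V \<and> v \<in> V")
    case True
    then have le: "lv u \<le> L" "lv v \<le> L" using lv_le by auto
    consider "lv v = Suc (lv u)" | "lv u = Suc (lv v)" | "lv v \<noteq> Suc (lv u)" "lv u \<noteq> Suc (lv v)"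
      by blast
    then show ?thesis
    proof cases
      case 1
      then have "reflected_lv u = Suc (reflected_lv v)" "reflected_lv v = L - Suc (lv u)" "lv u < L" using le unfolding reflected_lv_def by linarith+
      then show ?thesis using bits[of u v "lv u"] True 1 E_iff by simp
    next
      case 2
      then have "reflected_lv v = Suc (reflected_lv u)" "reflected_lv u = L - Suc (lv v)" "lv v < L" using le unfolding reflected_lv_def by linarith+
      then show ?thesis using bits[of u v "lv v"] True 2 E_iff by simp
    next
      case 3
      then have "reflected_lv v \<noteq> Suc (reflected_lv u)" "reflected_lv u \<noteq> Suc (reflected_lv v)" using le unfolding reflected_lv_def by linarith+
      then show ?thesis using 3 E_iff by simp
    qed
  qed (use E_iff in blast)
  show "reflected_lv v \<le> L" for v by (simp add: reflected_lv_def)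
  show "even i \<and> i < L" if "v \<in> V" "i \<in> reflected_wd v" for v i
    using wdD[of v "L - Suc i"] that odd_L by (auto simp: reflected_wd_def)
  show "u = v" if uv: "u \<in> V" "v \<in> V" and "reflected_lv u = reflected_lv v"
    and eq: "reflected_wd u = reflected_wd v" for u v
  proof (rule vertex_eqI[OF uv])
    show "lv u = lv v" using that lv_le[of u] lv_le[of v] unfolding reflected_lv_def by linarith
    have "i \<in> wd u \<longleftrightarrow> i \<in> wd v" if "i < L" for i
    proof -
      have "L - Suc i < L" "L - Suc (L - Suc i) = i" using that by linarith+
      moreover have "L - Suc i \<in> reflected_wd u \<longleftrightarrow>
          L - Suc i \<in> reflected_wd v" using eq by blast
      ultimately show ?thesis by (simp add: reflected_wd_def)
    qed
    then show "wd u = wd v" using wdD uv by blast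
  qed
  show "\<exists>v\<in>V. reflected_lv v = s \<and> reflected_wd v = X"
    if s: "s \<le> L" and X: "\<And>i. i \<in> X \<Longrightarrow> even i \<and> i < L" for s X
  proof -
    have "\<exists>v\<in>V. lv v = L - s \<and> wd v = {i. i < L \<and> L - Suc i \<in> X}"
    proof (rule vertex_ex)
      fix i assume "i \<in> {i. i < L \<and> L - Suc i \<in> X}"
      then show "even i \<and> i < L" using X[of "L - Suc i"] odd_L by auto
    qed simp
    then obtain v where v: "v \<in> V" "lv v = L - s" "wd v = {i. i < L \<and> L - Suc i \<in> X}" by blast
    have "reflected_wd v = X" using v(3) X unfolding reflected_wd_def by fastforce
    moreover have "reflected_lv v = s" using v(2) s by (simp add: reflected_lv_def)
    ultimately show ?thesis using v(1) by blast
  qed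
qed

lemma reflected_differ:
  "butterfly.differ reflected_wd u v i \<longleftrightarrow> i < L \<and> differ u v (L - Suc i)"
  using butterfly.differ_def[OF reflection] by (auto simp: differ_def reflected_wd_def)

abbreviation reflected_running :: "nat \<Rightarrow> nat list \<Rightarrow> nat \<Rightarrow> bool" where
  "reflected_running \<equiv> butterfly.running V reflected_lv reflected_wd"

text \<open>After the turn the robber runs downwards in the reflected graph, from a level so high
  that \<open>running\<close> puts no condition on spent cops: the count starts afresh.\<close>

lemma reflected_runningI:
  assumes "clear_above C r" "length C = k" "2 * k + 2 < L - lv r"
  shows "reflected_running k C r"
proof -
  interpret refl: butterfly L V E reflected_lv reflected_wd
    by (rule reflection)
  have "refl.clear_below C r"
    unfolding refl.clear_below_def
  proof (intro conjI ballI impI)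
    fix c assume c: "c \<in> set C" "reflected_lv c < reflected_lv r"
    then have "lv r < lv c" unfolding reflected_lv_def by linarith
    then obtain i where i: "i < lv r" "differ c r i"
      using assms(1) c(1) by (auto simp: clear_above_def)
    have "i < L" using i(1) assms(1) lv_le[of r] by (auto simp: clear_above_def)
    then have "L - Suc (L - Suc i) = i" "L - Suc i < L" "reflected_lv r \<le> L - Suc i"
      using i(1) unfolding reflected_lv_def by linarith+
    then show "\<exists>i\<ge>reflected_lv r. refl.differ c r i"
      using i(2) by (intro exI[of _ "L - Suc i"]) (simp add: reflected_differ)
  qed (use assms(1) in \<open>auto simp: clear_above_def\<close>)
  then show ?thesis using assms(2,3) by (simp add: refl.running_def reflected_lv_def)
qed

lemma running_if_reflected_clear_above:
  assumes "butterfly.clear_above V reflected_lv reflected_wd C r"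
    and "length C = k" "2 * k + 2 < lv r"
  shows "running k C r"
proof -
  interpret refl: butterfly L V E reflected_lv reflected_wd
    by (rule reflection)
  have CV: "set C \<subseteq> V" "r \<in> V" using assms(1) by (auto simp: refl.clear_above_def)
  have "clear_below C r"
    unfolding clear_below_def
  proof (intro conjI ballI impI)
    fix c assume c: "c \<in> set C" "lv c < lv r"
    then have "reflected_lv r < reflected_lv c"
      using lv_le[OF CV(2)] unfolding reflected_lv_def by linarith
    then obtain i where i: "i < reflected_lv r" "refl.differ c r i"
      using assms(1) c(1) by (auto simp: refl.clear_above_def)
    then have "differ c r (L - Suc i)" "lv r \<le> L - Suc i" by (auto simp: reflected_differ reflected_lv_def)
    then show "\<exists>i\<ge>lv r. differ c r i" by blast
  qed (use CV in auto)
  then show ?thesis using assms(2,3) by (simp add: running_def)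
qed

lemma running_not_surrounded:
  assumes "running k C r"
  shows "\<not> nbrs E r \<subseteq> set C"
  by (rule not_surrounded_below[of C r]) (use assms in \<open>auto simp: running_def clear_below_def\<close>)

section \<open>The strategy of the robber\<close>

text \<open>The start level \<open>2 * k + 3\<close> is the least where \<open>running\<close> holds
  without counting spent cops. The difference is arranged for all cops, since one on the robber's
  level may step below it before the robber moves.\<close>

lemma start_ex:
  assumes "length C = k" "set C \<subseteq> V" "4 * k + 6 \<le> L"
  obtains r where "r \<in> V" "r \<notin> set C" "\<not> nbrs E r \<subseteq> set C"
    "\<And>C'. vertex_cop_step E C C' \<Longrightarrow> running k C' r"
proof -
  \<comment> \<open>the j-th cop is made to differ from the robber in a bit of its own above the start level\<close>
  define b where "b j = 2 * k + 4 + 2 * j" for j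
  have b: "even (b j)" "2 * k + 4 \<le> b j" for j by (simp_all add: b_def)
  have bL: "b j < L" if "j < k" for j using that assms(3) by (simp add: b_def)
  have b_inj: "b i = b j \<longleftrightarrow> i = j" for i j by (simp add: b_def)
  define X where "X = {b j | j. j < k \<and> b j \<notin> wd (C ! j)}"
  have "\<exists>r\<in>V. lv r = 2 * k + 3 \<and> wd r = X"
    by (rule vertex_ex) (use assms(3) b(1) bL in \<open>auto simp: X_def\<close>)
  then obtain r where r: "r \<in> V" "lv r = 2 * k + 3" "wd r = X" by blast
  have diff: "differ (C ! j) r (b j)" if "j < k" for j
    using that r(3) b_inj by (auto simp: differ_def X_def)
  have far: "\<exists>i>lv r. differ c r i" if c: "c \<in> set C" for c
  proof -
    obtain j where "j < k" "c = C ! j" using c assms(1) by (metis in_set_conv_nth)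
    then show ?thesis using diff[of j] b(2)[of j] r(2) by (intro exI[of _ "b j"]) auto
  qed
  have "clear_below C r"
    unfolding clear_below_def using r(1) assms(2) far less_imp_le by blast
  moreover have "running k C' r" if C': "vertex_cop_step E C C'" for C'
  proof -
    have "clear_below C' r"
      unfolding clear_below_def
    proof (intro conjI ballI impI)
      fix c' assume c': "c' \<in> set C'" "lv c' < lv r"
      obtain c where c: "c \<in> set C" "c' = c \<or> E c c'" using cop_stepD[OF C' c'(1)] .
      obtain i where i: "i > lv r" "differ c r i" using far c(1) by blast
      then have "differ c' r i" using step_differ[OF c(2), of i r] step_lv[OF c(2)] c'(2) by linarith
      then show "\<exists>i\<ge>lv r. differ c' r i" using i(1) less_imp_le by blast
    qed (use r(1) cop_step_in_V[OF C' assms(2)] in auto)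
    then show ?thesis using C' assms(1) r(2) by (simp add: running_def vertex_cop_step_def)
  qed
  moreover have "r \<notin> set C" using far by (auto simp: differ_def)
  moreover have "\<not> nbrs E r \<subseteq> set C"
    by (rule not_surrounded_below[OF \<open>clear_below C r\<close>]) (use r in auto)
  ultimately show thesis using that r(1) by blast
qed

lemma robber_evades:
  assumes L: "4 * k + 6 \<le> L"
  shows "\<not> k_cops_win V (\<lambda>C r. r \<in> V \<and> r \<notin> set C) (vertex_cop_step E)
      (\<lambda>C r r'. robber_move E r r' \<and> r' \<notin> set C) (\<lambda>C r. nbrs E r \<subseteq> set C) k"
proof -
  interpret refl: butterfly L V E reflected_lv reflected_wd
    by (rule reflection)
  let ?run = "\<lambda>C r. running k C r \<or> reflected_running k C r"
  \<comment> \<open>\<open>running\<close> describes positions with the robber to move; before a cop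
    move it is demanded after every possible reply.\<close>
  let ?I = "\<lambda>C r t. \<not> nbrs E r \<subseteq> set C \<and>
    (if t then \<forall>C'. vertex_cop_step E C C' \<longrightarrow> ?run C' r else ?run C r)"
  have evade: "\<not> cops_win (vertex_cop_step E) (\<lambda>C r r'. robber_move E r r' \<and> r' \<notin> set C)
      (\<lambda>C r. nbrs E r \<subseteq> set C) C r t" if "?I C r t" for C r t
  proof (rule not_cops_winI[of ?I, OF that])
    show "?I C' r False" if "?I C r True" "vertex_cop_step E C C'" for C C' r
    proof -
      have "?run C' r" using that by simp
      then show ?thesis using running_not_surrounded refl.running_not_surrounded by auto
    qed
    show "\<exists>r'. (robber_move E r r' \<and> r' \<notin> set C) \<and> ?I C r' True" if "?I C r False" for C r
    proof -
      have "?run C r" using that by simp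
      then have "\<exists>r'. E r r' \<and> r' \<notin> set C \<and> \<not> nbrs E r' \<subseteq> set C \<and>
          (\<forall>C'. vertex_cop_step E C C' \<longrightarrow> ?run C' r')"
      proof
        assume "running k C r"
        from running_step[OF this L] show ?thesis using reflected_runningI by blast
      next
        assume "reflected_running k C r"
        from refl.running_step[OF this L] obtain r' where r': "E r r'" "r' \<notin> set C"
          "\<not> nbrs E r' \<subseteq> set C" "\<And>C'. vertex_cop_step E C C' \<Longrightarrow>
            reflected_running k C' r' \<or>
            length C' = k \<and> refl.clear_above C' r' \<and> 2 * k + 2 < L - reflected_lv r'" by blast
        have "L - reflected_lv r' = lv r'"
          using lv_le E_in_V[OF r'(1)] by (simp add: reflected_lv_def)
        then show ?thesis using r' running_if_reflected_clear_above by metis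
      qed
      then show ?thesis by (auto simp: robber_move_def)
    qed
  qed auto
  show ?thesis
  proof
    assume "k_cops_win V (\<lambda>C r. r \<in> V \<and> r \<notin> set C) (vertex_cop_step E)
      (\<lambda>C r r'. robber_move E r r' \<and> r' \<notin> set C) (\<lambda>C r. nbrs E r \<subseteq> set C) k"
    then obtain C where C: "length C = k" "set C \<subseteq> V"
      and win: "\<And>r. r \<in> V \<Longrightarrow> r \<notin> set C \<Longrightarrow> cops_win (vertex_cop_step E)
        (\<lambda>C r r'. robber_move E r r' \<and> r' \<notin> set C) (\<lambda>C r. nbrs E r \<subseteq> set C) C r True"
      unfolding k_cops_win_def by blast
    obtain r where r: "r \<in> V" "r \<notin> set C" "\<not> nbrs E r \<subseteq> set C"
      "\<And>C'. vertex_cop_step E C C' \<Longrightarrow> running k C' r" using start_ex[OF C L] by blast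
    then have "?I C r True" by simp
    from evade[OF this] win[OF r(1,2)] show False by blast
  qed
qed

section \<open>The classical game\<close>

text \<open>A climbing cop has every differing bit still ahead of it and can match each one as it
  crosses it; on reaching the robber's level it becomes a \<open>guard\<close>.\<close>

definition sweep :: "nat \<Rightarrow> nat \<Rightarrow> nat \<Rightarrow> bool" where
  "sweep q c r \<longleftrightarrow> c \<in> V \<and> r \<in> V \<and> lv c \<le> lv r \<and> (\<forall>i. differ c r i \<longrightarrow> lv c \<le> i \<and> i < q)"

definition guard :: "nat \<Rightarrow> nat \<Rightarrow> nat \<Rightarrow> bool" where
  "guard q c r \<longleftrightarrow> sweep q c r \<and> lv c = lv r"

lemma guard_caught: "guard q c r \<Longrightarrow> q \<le> lv r \<Longrightarrow> c = r"
  unfolding guard_def sweep_def by (rule eq_if_no_differ) auto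

text \<open>The bit crossed by both pieces ends up equal, so a move up settles the lowest candidate
  and a move down adds none.\<close>

lemma guard_step:
  assumes g: "guard q c r" and r': "r' = r \<or> E r r'"
  obtains c' where "c' = c \<or> E c c'" "guard q c' r'"
proof (cases "r' = r")
  case True
  then show ?thesis using g that by blast
next
  case False
  then have r': "E r r'" using r' by simp
  have V: "c \<in> V" "r \<in> V" "r' \<in> V" and eq: "lv c = lv r"
    and d: "\<And>i. differ c r i \<Longrightarrow> lv r \<le> i \<and> i < q"
    using g E_in_V[OF r'] by (auto simp: guard_def sweep_def)
  consider "lv r' = Suc (lv r)" | "lv r = Suc (lv r')" using E_lv[OF r'] by blast
  then show ?thesis
  proof cases
    case 1
    then have "lv c < L" using eq lv_le[OF V(3)] by simp
    then obtain c' where c': "E c c'" "lv c' = Suc (lv c)"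
      "\<And>i. differ c' r' i \<longleftrightarrow> differ c r' i \<and> i \<noteq> lv c" using up_towards[OF V(1,3)] by blast
    have "lv r' \<le> i \<and> i < q" if "differ c' r' i" for i
    proof -
      have i: "differ c r' i" "i \<noteq> lv r" using that c'(3) eq by auto
      then have "differ c r i" using step_differ(2)[of r' r i c] r' 1 by force
      then show ?thesis using d[of i] i(2) 1 by simp
    qed
    then have "guard q c' r'" using c' V eq 1 E_in_V[OF c'(1)] by (auto simp: guard_def sweep_def)
    then show ?thesis using that c'(1) by blast
  next
    case 2
    then obtain c' where c': "E c c'" "lv c' = lv r'"
      "\<And>i. differ c' r' i \<longleftrightarrow> differ c r' i \<and> i \<noteq> lv r'" using down_towards[OF V(1,3)] eq by metis
    have "lv r' \<le> i \<and> i < q" if "differ c' r' i" for i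
    proof -
      have i: "differ c r' i" "i \<noteq> lv r'" using that c'(3) by auto
      then have "differ c r i" using step_differ(2)[of r' r i c] r' 2 by force
      then show ?thesis using d[of i] 2 by simp
    qed
    then have "guard q c' r'" using c' V E_in_V[OF c'(1)] by (auto simp: guard_def sweep_def)
    then show ?thesis using that c'(1) by blast
  qed
qed

lemma robber_step_differ:
  assumes "r' = r \<or> E r r'" "differ c r' i" "q \<le> i" "lv r \<le> q" "lv r' \<le> q"
  shows "differ c r i"
  using assms step_differ(2)[OF assms(1), of i c] by linarith

text \<open>If both moved towards each other they could change places. So when the robber steps down
  to the cop's level, the cop waits and is a guard there; otherwise it climbs and settles bit
  \<open>lv c\<close>.\<close>

lemma sweep_step:
  assumes s: "sweep q c r" and less: "lv c < lv r" and r': "r' = r \<or> E r r'"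
    and q: "lv r \<le> q" "lv r' \<le> q"
  obtains c' where "c' = c \<or> E c c'" "guard q c' r' \<or> sweep q c' r' \<and> lv c' = Suc (lv c)"
proof -
  have V: "c \<in> V" "r \<in> V" "r' \<in> V" and d: "\<And>i. differ c r i \<Longrightarrow> lv c \<le> i \<and> i < q"
    using s r' E_in_V by (auto simp: sweep_def)
  have le: "lv c \<le> lv r'" using step_lv[OF r'] less by linarith
  have d': "lv c \<le> i \<and> i < q" if "differ c r' i" for i
  proof -
    have "i < q" using robber_step_differ[OF r' that _ q] d[of i] by force
    moreover have "lv c \<le> i"
      using step_differ(2)[OF r', of i c] that d[of i] less le by force
    ultimately show ?thesis by simp
  qed
  show thesis
  proof (cases "lv r' = lv c")
    case True
    then have "guard q c r'" using V d' by (auto simp: guard_def sweep_def)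
    then show thesis using that by blast
  next
    case False
    then have "lv c < L" using le lv_le[OF V(3)] by linarith
    then obtain c' where c': "E c c'" "lv c' = Suc (lv c)"
      "\<And>i. differ c' r' i \<longleftrightarrow> differ c r' i \<and> i \<noteq> lv c" using up_towards[OF V(1,3)] by blast
    have "Suc (lv c) \<le> i \<and> i < q" if "differ c' r' i" for i
      using d'[of i] that c'(3) by (metis Suc_leI le_neq_implies_less)
    then have "sweep q c' r'" using c' V le False E_in_V[OF c'(1)] by (auto simp: sweep_def)
    then show thesis using that c' by blast
  qed
qed

section \<open>Two cops capture the robber\<close>

abbreviation classic_win :: "nat list \<Rightarrow> nat \<Rightarrow> bool \<Rightarrow> bool" where
  "classic_win \<equiv> cops_win (vertex_cop_step E) (\<lambda>C r r'. robber_move E r r') (\<lambda>C r. r \<in> set C)"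

text \<open>Used when the second cop has become the better guard and the two exchange roles.\<close>

lemma classic_win_swap: "classic_win [a, b] r t \<Longrightarrow> classic_win [b, a] r t"
proof (erule cops_win_simulation[where R = "\<lambda>C D. \<exists>a b. C = [a, b] \<and> D = [b, a]"])
  fix C C' D :: "nat list"
  assume "\<exists>a b. C = [a, b] \<and> D = [b, a]" and step: "vertex_cop_step E C C'"
  then obtain a b where C: "C = [a, b]" "D = [b, a]" by blast
  then have "length C' = 2" using step by (simp add: vertex_cop_step_def)
  then obtain a' b' where C': "C' = [a', b']" by (auto simp: length_Suc_conv numeral_2_eq_2)
  have "vertex_cop_step E D [b', a']"
    using step C C' by (auto simp: vertex_cop_step_def less_Suc_eq_0_disj all_conj_distrib)
  then show "\<exists>D'. vertex_cop_step E D D' \<and> (\<exists>a b. C' = [a, b] \<and> D' = [b, a])" using C' by blast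
qed auto

lemma classic_winI:
  assumes "\<And>r'. r' = r \<or> E r r' \<Longrightarrow>
    \<exists>a' b'. (a' = a \<or> E a a') \<and> (b' = b \<or> E b b') \<and> classic_win [a', b'] r' False"
  shows "classic_win [a, b] r False"
proof (rule cops_win.rob_turn, intro allI impI)
  fix r' assume "robber_move E r r'"
  then have "r' = r \<or> E r r'" by (simp add: robber_move_def)
  from assms[OF this] obtain a' b'
    where ab: "a' = a \<or> E a a'" "b' = b \<or> E b b'" "classic_win [a', b'] r' False" by blast
  then have "vertex_cop_step E [a, b] [a', b']"
    by (auto simp: vertex_cop_step_def less_Suc_eq_0_disj)
  then show "classic_win [a, b] r' True" using ab(3) by (rule cops_win.cop_turn)
qed

text \<open>\<open>A\<close> is the claim for the smaller bound. The guard for \<open>Suc q\<close>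
  catches a robber who leaves the levels up to \<open>q\<close>; meanwhile the other cop climbs
  until it is level with the robber and a guard for \<open>q\<close>.\<close>

lemma guard_sweep_win:
  assumes A: "\<And>c1 c2 r. guard q c1 r \<Longrightarrow> c2 \<in> V \<Longrightarrow> classic_win [c1, c2] r False"
  shows "guard (Suc q) c1 r \<Longrightarrow> sweep q c2 r \<Longrightarrow> classic_win [c1, c2] r False"
proof (induction "L - lv c2" arbitrary: c1 c2 r rule: less_induct)
  case less
  have c1: "c1 \<in> V" using less.prems by (simp add: guard_def sweep_def)
  show ?case
  proof (cases "lv c2 = lv r")
    case True
    then have "guard q c2 r" using less.prems by (simp add: guard_def)
    then show ?thesis using A c1 classic_win_swap by blast
  next
    case False
    then have lt: "lv c2 < lv r" using less.prems(2) by (simp add: sweep_def)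
    show ?thesis
    proof (cases "lv r \<le> q")
      case False
      then have "c1 = r" using guard_caught less.prems(1) by simp
      then show ?thesis by (simp add: cops_win.done_win)
    next
      case r_le: True
      show ?thesis
      proof (rule classic_winI)
        fix r' assume r': "r' = r \<or> E r r'"
        obtain c1' where c1': "c1' = c1 \<or> E c1 c1'" "guard (Suc q) c1' r'"
          using guard_step[OF less.prems(1) r'] .
        show "\<exists>a b. (a = c1 \<or> E c1 a) \<and> (b = c2 \<or> E c2 b) \<and> classic_win [a, b] r' False"
        proof (cases "lv r' \<le> q")
          case False
          then have "c1' = r'" using guard_caught c1'(2) by simp
          then have "classic_win [c1', c2] r' False" by (simp add: cops_win.done_win)
          then show ?thesis using c1'(1) by blast
        next
          case True
          obtain c2' where c2': "c2' = c2 \<or> E c2 c2'"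
            "guard q c2' r' \<or> sweep q c2' r' \<and> lv c2' = Suc (lv c2)"
            using sweep_step[OF less.prems(2) lt r' r_le True] .
          from c2'(2) have "classic_win [c1', c2'] r' False"
          proof
            assume "guard q c2' r'"
            then show ?thesis using A c1' classic_win_swap by (auto simp: guard_def sweep_def)
          next
            assume s: "sweep q c2' r' \<and> lv c2' = Suc (lv c2)"
            then have "L - lv c2' < L - lv c2" using lv_le[of c2'] by (auto simp: sweep_def)
            then show ?thesis using less.hyps c1'(2) s by blast
          qed
          then show ?thesis using c1'(1) c2'(1) by blast
        qed
      qed
    qed
  qed
qed

text \<open>
  The guarded robber stays at levels up to q and so never crosses bit q or any higher one; what
  the second cop fixes there on its way down remains fixed.
\<close>

lemma guard_descend_win:
  assumes A: "\<And>c1 c2 r. guard q c1 r \<Longrightarrow> c2 \<in> V \<Longrightarrow> classic_win [c1, c2] r False"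
  shows "guard (Suc q) c1 r \<Longrightarrow> c2 \<in> V \<Longrightarrow> (\<And>i. differ c2 r i \<Longrightarrow> i < lv c2 \<or> i < q) \<Longrightarrow>
    classic_win [c1, c2] r False"
proof (induction "lv c2" arbitrary: c1 c2 r)
  case 0
  have "sweep q c2 r"
    using 0 by (fastforce simp: sweep_def guard_def)
  then show ?case using guard_sweep_win[OF A] 0 by blast
next
  case (Suc s)
  show ?case
  proof (cases "lv r \<le> q")
    case False
    then have "c1 = r" using guard_caught Suc.prems(1) by simp
    then show ?thesis by (simp add: cops_win.done_win)
  next
    case r_le: True
    show ?thesis
    proof (rule classic_winI)
      fix r' assume r': "r' = r \<or> E r r'"
      obtain c1' where c1': "c1' = c1 \<or> E c1 c1'" "guard (Suc q) c1' r'"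
        using guard_step[OF Suc.prems(1) r'] .
      then have "r' \<in> V" by (simp add: guard_def sweep_def)
      then obtain c2' where c2': "E c2 c2'" "lv c2' = s"
        "\<And>i. differ c2' r' i \<longleftrightarrow> differ c2 r' i \<and> i \<noteq> s"
        using down_towards[OF Suc.prems(2)] Suc.hyps(2) by metis
      have "classic_win [c1', c2'] r' False"
      proof (cases "lv r' \<le> q")
        case False
        then have "c1' = r'" using guard_caught c1'(2) by simp
        then show ?thesis by (simp add: cops_win.done_win)
      next
        case True
        have "i < lv c2' \<or> i < q" if "differ c2' r' i" for i
        proof (cases "i < q")
          case False
          then have "differ c2 r i" using robber_step_differ[OF r' _ _ r_le True] that c2'(3) by simp
          then have "i < Suc s" using Suc.prems(3) Suc.hyps(2) False by force
          then show ?thesis using that c2'(2,3) by (simp add: less_Suc_eq)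
        qed simp
        then show ?thesis using Suc.hyps(1)[of c2' c1' r'] c1'(2) c2' E_in_V by blast
      qed
      then show "\<exists>a b. (a = c1 \<or> E c1 a) \<and> (b = c2 \<or> E c2 b) \<and> classic_win [a, b] r' False"
        using c1'(1) c2'(1) by blast
    qed
  qed
qed

text \<open>At the top level every bit lies below the cop, which is what the descent asks for, so
  the climb itself may be straight.\<close>

lemma guard_ascend_win:
  assumes A: "\<And>c1 c2 r. guard q c1 r \<Longrightarrow> c2 \<in> V \<Longrightarrow> classic_win [c1, c2] r False"
  shows "guard (Suc q) c1 r \<Longrightarrow> c2 \<in> V \<Longrightarrow> classic_win [c1, c2] r False"
proof (induction "L - lv c2" arbitrary: c1 c2 r rule: less_induct)
  case less
  show ?case
  proof (cases "lv c2 < L")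
    case False
    then have "i < lv c2" if "differ c2 r i" for i
      using that differD[OF less.prems(2)] less.prems(1) by (force simp: guard_def sweep_def)
    then show ?thesis using guard_descend_win[OF A less.prems] by blast
  next
    case True
    obtain c2' where c2': "E c2 c2'" "lv c2' = Suc (lv c2)"
      using straight_up[OF less.prems(2) True] .
    show ?thesis
    proof (rule classic_winI)
      fix r' assume r': "r' = r \<or> E r r'"
      obtain c1' where c1': "c1' = c1 \<or> E c1 c1'" "guard (Suc q) c1' r'"
        using guard_step[OF less.prems(1) r'] .
      have "classic_win [c1', c2'] r' False"
        using less.hyps[OF _ c1'(2)] c2' True E_in_V[OF c2'(1)] by auto
      then show "\<exists>a b. (a = c1 \<or> E c1 a) \<and> (b = c2 \<or> E c2 b) \<and> classic_win [a, b] r' False"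
        using c1'(1) c2'(1) by blast
    qed
  qed
qed

text \<open>Each round of climbing, descending and sweeping lowers the bound of the guard by one;
  with bound 0 no differing bit is left.\<close>

lemma guard_win: "guard q c1 r \<Longrightarrow> c2 \<in> V \<Longrightarrow> classic_win [c1, c2] r False"
proof (induction q arbitrary: c1 c2 r)
  case 0
  then have "c1 = r" using guard_caught by blast
  then show ?case by (simp add: cops_win.done_win)
next
  case (Suc q)
  then show ?case using guard_ascend_win by blast
qed

text \<open>With bound \<open>L\<close> the top of the graph confines the robber in place of a
  guard.\<close>

lemma sweep_win: "sweep L c1 r \<Longrightarrow> c2 \<in> V \<Longrightarrow> classic_win [c1, c2] r False"
proof (induction "L - lv c1" arbitrary: c1 r rule: less_induct)
  case less
  show ?case
  proof (cases "lv c1 = lv r")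
    case True
    then show ?thesis using less.prems guard_win by (simp add: guard_def)
  next
    case False
    then have lt: "lv c1 < lv r" using less.prems(1) by (simp add: sweep_def)
    show ?thesis
    proof (rule classic_winI)
      fix r' assume r': "r' = r \<or> E r r'"
      then have "lv r \<le> L" "lv r' \<le> L"
        using lv_le less.prems(1) E_in_V by (auto simp: sweep_def)
      then obtain c1' where c1': "c1' = c1 \<or> E c1 c1'"
        "guard L c1' r' \<or> sweep L c1' r' \<and> lv c1' = Suc (lv c1)"
        using sweep_step[OF less.prems(1) lt r'] by blast
      from c1'(2) have "classic_win [c1', c2] r' False"
      proof
        assume "guard L c1' r'"
        then show ?thesis using guard_win less.prems(2) by blast
      next
        assume s: "sweep L c1' r' \<and> lv c1' = Suc (lv c1)"
        then have "L - lv c1' < L - lv c1" using lv_le[of c1'] by (auto simp: sweep_def)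
        then show ?thesis using less.hyps less.prems(2) s by blast
      qed
      then show "\<exists>a b. (a = c1 \<or> E c1 a) \<and> (b = c2 \<or> E c2 b) \<and> classic_win [a, b] r' False"
        using c1'(1) by blast
    qed
  qed
qed

lemma two_cops_win:
  "k_cops_win V (\<lambda>C r. r \<in> V) (vertex_cop_step E) (\<lambda>C r r'. robber_move E r r')
    (\<lambda>C r. r \<in> set C) 2"
proof -
  obtain c where c: "c \<in> V" "lv c = 0" using vertex_ex[of 0 "{}"] by auto
  have "classic_win [c, c] r True" if "r \<in> V" for r
  proof (rule cops_win.cop_turn)
    show "vertex_cop_step E [c, c] [c, c]" by (simp add: vertex_cop_step_def)
    \<comment> \<open>Seen from level 0 every bit is ahead of the cop, wherever the robber
      starts.\<close>
    have "sweep L c r" using c that differD by (auto simp: sweep_def)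
    then show "classic_win [c, c] r False" using sweep_win c(1) by blast
  qed
  then show ?thesis unfolding k_cops_win_def using c(1)
    by (intro exI[of _ "[c, c]"]) auto
qed

section \<open>One cop is not enough\<close>

text \<open>An even level is not the top one, as \<open>L\<close> is odd, and has a bit above it; an
  odd level has a bit below it. Crossing that bit with and without flipping it gives two
  neighbours.\<close>

lemma other_nbr:
  assumes "r \<in> V"
  obtains v where "E r v" "v \<noteq> c"
proof (cases "even (lv r)")
  case True
  then have lt: "lv r < L" using lv_le[OF assms] odd_L le_neq_implies_less by blast
  obtain u where u: "E r u" "wd u = wd r" using straight_up[OF assms lt] by blast
  obtain v where v: "E r v" "\<And>i. i \<in> wd v \<longleftrightarrow> (i \<in> wd r) \<noteq> (i = lv r)"
    using cross_up[OF assms lt True] by blast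
  have "u \<noteq> v" using u(2) v(2)[of "lv r"] by auto
  then show thesis using that u(1) v(1) by blast
next
  case False
  then obtain s where s: "lv r = Suc s" "even s" by (metis even_Suc even_zero not0_implies_Suc)
  obtain u where u: "E r u" "wd u = wd r" using straight_down[OF assms s(1)] by blast
  obtain v where v: "E r v" "\<And>i. i \<in> wd v \<longleftrightarrow> (i \<in> wd r) \<noteq> (i = s)"
    using cross_down[OF assms s] by blast
  have "u \<noteq> v" using u(2) v(2)[of s] by auto
  then show thesis using that u(1) v(1) by blast
qed

lemma one_cop_loses:
  assumes "k \<le> 1"
  shows "\<not> k_cops_win V (\<lambda>C r. r \<in> V) (vertex_cop_step E) (\<lambda>C r r'. robber_move E r r')
    (\<lambda>C r. r \<in> set C) k"
proof
  let ?I = "\<lambda>C r t. length C \<le> 1 \<and> r \<in> V \<and> r \<notin> set C \<and> (t \<longrightarrow> (\<forall>c\<in>set C. \<not> E c r))"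
  assume "k_cops_win V (\<lambda>C r. r \<in> V) (vertex_cop_step E) (\<lambda>C r r'. robber_move E r r')
    (\<lambda>C r. r \<in> set C) k"
  then obtain C where C: "length C \<le> 1" "set C \<subseteq> V"
    and win: "\<And>r. r \<in> V \<Longrightarrow> classic_win C r True"
    unfolding k_cops_win_def using assms by blast
  obtain c where c: "c \<in> V" "set C \<subseteq> {c}"
  proof (cases C)
    case Nil
    then show thesis using that vertex_ex[of 0 "{}"] by auto
  next
    case (Cons c C')
    then show thesis using that C by auto
  qed
  \<comment> \<open>The same level with another word is neither the cop's vertex nor adjacent to it.
    Bit 0 exists because an odd \<open>L\<close> is positive.\<close>
  have "\<exists>r\<in>V. lv r = lv c \<and> wd r = {i. (i \<in> wd c) \<noteq> (i = 0)}"
    by (rule vertex_ex) (use lv_le[OF c(1)] wdD[OF c(1)] odd_L in \<open>auto elim: oddE\<close>)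
  then obtain r where r: "r \<in> V" "lv r = lv c" "wd r = {i. (i \<in> wd c) \<noteq> (i = 0)}" by blast
  have "r \<noteq> c" using r(3) by auto
  moreover have "\<not> E c r" using E_lv[of c r] r(2) by auto
  ultimately have "?I C r True" using C(1) c(2) r(1) by auto
  then have "\<not> classic_win C r True"
  proof (rule not_cops_winI[of ?I])
    fix C C' r assume I: "?I C r True" and step: "vertex_cop_step E C C'"
    have "r \<notin> set C'" using I cop_stepD[OF step, of r] by metis
    then show "?I C' r False" using I step by (simp add: vertex_cop_step_def)
  next
    fix C r assume I: "?I C r False"
    show "\<exists>r'. robber_move E r r' \<and> ?I C r' True"
    proof (cases "\<exists>c\<in>set C. E c r")
      case False
      then show ?thesis using I by (auto simp: robber_move_def)
    next
      case True
      then obtain c where c: "c \<in> set C" "E c r" by blast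
      then have "C = [c]" using I by (cases C) auto
      obtain r' where r': "E r r'" "r' \<noteq> c" using other_nbr I by blast
      \<comment> \<open>Levels change by one along an edge, so by parity there are no
        triangles.\<close>
      have "\<not> E c r'" using E_lv[OF c(2)] E_lv[OF r'(1)] E_lv[of c r'] by auto
      then show ?thesis
        using r' \<open>C = [c]\<close> E_in_V[OF r'(1)] by (auto simp: robber_move_def)
    qed
  qed simp
  then show False using win r(1) by blast
qed

lemma cop_number_eq_2: "cop_number V E = 2"
  unfolding cop_number_def
proof (rule Least_equality)
  show "2 \<le> k" if "k_cops_win V (\<lambda>C r. r \<in> V) (vertex_cop_step E) (\<lambda>C r r'. robber_move E r r')
    (\<lambda>C r. r \<in> set C) k" for k
    using one_cop_loses[of k] that by linarith
qed (rule two_cops_win)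

section \<open>Connectedness and maximum degree\<close>

lemma connected: "connected_graph V E"
proof -
  obtain z where z: "z \<in> V" "lv z = 0" "wd z = {}" using vertex_ex[of 0 "{}"] by auto
  \<comment> \<open>The way down to level 0 can correct every bit below \<open>u\<close>; climbing
    to the top first puts all bits below.\<close>
  have down: "E\<^sup>*\<^sup>* u z" if "u \<in> V" "\<And>i. differ u z i \<Longrightarrow> i < lv u" for u
    using that
  proof (induction "lv u" arbitrary: u)
    case 0
    then have "lv u = 0" by simp
    then have "\<not> differ u z i" for i using "0.prems"(2)[of i] by auto
    then have "u = z" using eq_if_no_differ[OF "0.prems"(1) z(1)] \<open>lv u = 0\<close> z(2) by simp
    then show ?case by simp
  next
    case (Suc s)
    have l: "lv u = Suc s" using Suc.hyps(2) by simp
    obtain v where v: "E u v" "lv v = s" "\<And>i. differ v z i \<longleftrightarrow> differ u z i \<and> i \<noteq> s"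
      using down_towards[OF Suc.prems(1) z(1) l] by blast
    have "i < lv v" if "differ v z i" for i
      using Suc.prems(2)[of i] v(2,3) that unfolding l by (simp add: less_Suc_eq)
    then have "E\<^sup>*\<^sup>* v z" using Suc.hyps(1)[of v] v(1,2) E_in_V by blast
    then show ?case by (rule converse_rtranclp_into_rtranclp[of E, OF v(1)])
  qed
  have to_z: "E\<^sup>*\<^sup>* u z" if "u \<in> V" for u
    using that
  proof (induction "L - lv u" arbitrary: u rule: less_induct)
    case less
    show ?case
    proof (cases "lv u < L")
      case True
      obtain v where v: "E u v" "lv v = Suc (lv u)" using straight_up[OF less.prems True] .
      have "E\<^sup>*\<^sup>* v z" using less.hyps[of v] v True E_in_V by auto
      then show ?thesis by (rule converse_rtranclp_into_rtranclp[of E, OF v(1)])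
    next
      case False
      then show ?thesis using down less.prems differD[OF less.prems z(1)] by force
    qed
  qed
  have "symp E" using E_sym by (rule sympI)
  then have "E\<^sup>*\<^sup>* z u" if "u \<in> V" for u
    using to_z[OF that] by (metis symp_rtranclp sympD)
  then show ?thesis
    unfolding connected_graph_def using to_z z(1) by (auto intro: rtranclp_trans)
qed

lemma card_nbrs_le:
  assumes "v \<in> V"
  shows "finite (nbrs E v) \<and> card (nbrs E v) \<le> 3"
proof -
  \<comment> \<open>\<open>m\<close> is the even bit next to the level of \<open>v\<close> and
    \<open>s\<close> the level across it; only this crossing can change the word. At level 0 the
    truncated \<open>lv v - 1\<close> lists \<open>v\<close> itself, harmless in an upper
    bound.\<close>
  define m where "m = (if even (lv v) then lv v else lv v - 1)"
  define s where "s = (if even (lv v) then Suc (lv v) else lv v - 1)"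
  let ?f = "\<lambda>u. (lv u, wd u)"
  let ?T = "{(lv v - 1, wd v), (Suc (lv v), wd v), (s, {i. (i \<in> wd v) \<noteq> (i = m)})}"
  have inj: "inj_on ?f (nbrs E v)"
    by (rule inj_onI) (auto simp: nbrs_def dest: E_in_V intro: vertex_eqI)
  have "?f u \<in> ?T" if "u \<in> nbrs E v" for u
  proof -
    have E: "E v u" using that by (simp add: nbrs_def)
    then have V: "u \<in> V" using E_in_V by blast
    define b where "b = min (lv u) (lv v)"
    have b: "\<And>i. i \<noteq> b \<Longrightarrow> i \<in> wd u \<longleftrightarrow> i \<in> wd v" and l: "lv u = Suc (lv v) \<or> lv v = Suc (lv u)"
      using E unfolding E_iff b_def by auto
    show ?thesis
    proof (cases "b \<in> wd u \<longleftrightarrow> b \<in> wd v")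
      case True
      then have "wd u = wd v" using b by (metis set_eqI)
      then show ?thesis using l by auto
    next
      case False
      then have "even b" using wdD[OF V, of b] wdD[OF assms, of b] by blast
      moreover have "wd u = {i. (i \<in> wd v) \<noteq> (i = b)}"
      proof (rule set_eqI)
        show "i \<in> wd u \<longleftrightarrow> i \<in> {i. (i \<in> wd v) \<noteq> (i = b)}" for i
          using b[of i] False by (cases "i = b") auto
      qed
      moreover have "even b \<Longrightarrow> b = m \<and> lv u = s"
        using l by (elim disjE) (simp_all add: m_def s_def b_def)
      ultimately show ?thesis by simp
    qed
  qed
  then have sub: "?f ` nbrs E v \<subseteq> ?T" by blast
  have "finite (nbrs E v)" using finite_imageD[OF finite_subset[OF sub] inj] by blast
  moreover have "card (?f ` nbrs E v) \<le> card ?T" by (rule card_mono[OF _ sub]) simp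
  moreover have "card ?T \<le> 3" by (simp add: card_insert_if)
  ultimately show ?thesis unfolding card_image[OF inj] by simp
qed

lemma max_degree_eq_3:
  assumes "finite V" "3 \<le> L"
  shows "max_degree V E = 3"
  unfolding max_degree_def
proof (rule Max_eqI)
  show "finite ((\<lambda>v. card (nbrs E v)) ` V)" using assms(1) by simp
  show "y \<le> 3" if "y \<in> (\<lambda>v. card (nbrs E v)) ` V" for y using that card_nbrs_le by auto
  \<comment> \<open>Level 2 is even and inner, so a straight neighbour below, a straight one above
    and a crossing one all exist.\<close>
  obtain v where v: "v \<in> V" "lv v = 2" using vertex_ex[of 2 "{}"] assms(2) by auto
  obtain a where a: "E v a" "lv a = 1" using straight_down[OF v(1), of 1] v(2) by auto
  obtain b where b: "E v b" "lv b = 3" "wd b = wd v" using straight_up[OF v(1)] v(2) assms(2) by auto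
  obtain c where c: "E v c" "lv c = 3" "\<And>i. i \<in> wd c \<longleftrightarrow> (i \<in> wd v) \<noteq> (i = 2)"
    using cross_up[OF v(1)] v(2) assms(2) by auto
  have "a \<noteq> b" "a \<noteq> c" "b \<noteq> c" using a(2) b(2,3) c(2) c(3)[of 2] by auto
  then have "card {a, b, c} = 3" by simp
  moreover have "{a, b, c} \<subseteq> nbrs E v" using a(1) b(1) c(1) by (auto simp: nbrs_def)
  ultimately have "3 \<le> card (nbrs E v)" using card_nbrs_le[OF v(1)] card_mono by metis
  then have "card (nbrs E v) = 3" using card_nbrs_le[OF v(1)] by simp
  then show "3 \<in> (\<lambda>v. card (nbrs E v)) ` V" using v(1) by force
qed

end

section \<open>Coding butterflies by natural numbers\<close>

text \<open>A vertex number codes a pair of a level and a bit mask.\<close>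

definition bf_level :: "nat \<Rightarrow> nat" where
  "bf_level v = fst (prod_decode v)"

definition bf_word :: "nat \<Rightarrow> nat set" where
  "bf_word v = set_decode (snd (prod_decode v))"

definition bf_verts :: "nat \<Rightarrow> nat set" where
  "bf_verts L = {v. bf_level v \<le> L \<and> (\<forall>i\<in>bf_word v. even i \<and> i < L)}"

definition bf_adj :: "nat \<Rightarrow> nat \<Rightarrow> nat \<Rightarrow> bool" where
  "bf_adj L u v \<longleftrightarrow> u \<in> bf_verts L \<and> v \<in> bf_verts L \<and>
     (bf_level v = Suc (bf_level u) \<and> (\<forall>i. i \<noteq> bf_level u \<longrightarrow> (i \<in> bf_word v \<longleftrightarrow> i \<in> bf_word u)) \<or>
      bf_level u = Suc (bf_level v) \<and> (\<forall>i. i \<noteq> bf_level v \<longrightarrow> (i \<in> bf_word v \<longleftrightarrow> i \<in> bf_word u)))"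

lemma bf_eqI: "bf_level u = bf_level v \<Longrightarrow> bf_word u = bf_word v \<Longrightarrow> u = v"
  unfolding bf_level_def bf_word_def
proof -
  assume "fst (prod_decode u) = fst (prod_decode v)"
    and words: "set_decode (snd (prod_decode u)) = set_decode (snd (prod_decode v))"
  moreover have "snd (prod_decode u) = snd (prod_decode v)"
    using arg_cong[OF words, of set_encode] by simp
  ultimately have "prod_decode u = prod_decode v" by (intro prod_eqI)
  then show "u = v" by simp
qed

lemma butterfly_bf:
  assumes "odd L"
  shows "butterfly L (bf_verts L) (bf_adj L) bf_level bf_word"
proof
  show "\<exists>v\<in>bf_verts L. bf_level v = s \<and> bf_word v = X"
    if s: "s \<le> L" and X: "\<And>i. i \<in> X \<Longrightarrow> even i \<and> i < L" for s X
  proof -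
    have "X \<subseteq> {..<L}" using X by blast
    then have "finite X" by (rule finite_subset) simp
    then have "bf_level (prod_encode (s, set_encode X)) = s" "bf_word (prod_encode (s, set_encode X)) = X"
      by (simp_all add: bf_level_def bf_word_def)
    then show ?thesis using s X by (intro bexI[of _ "prod_encode (s, set_encode X)"]) (auto simp: bf_verts_def)
  qed
next
  show "u = v" if "bf_level u = bf_level v" "bf_word u = bf_word v" for u v
    using bf_eqI that .
qed (use assms in \<open>auto simp: bf_verts_def bf_adj_def\<close>)

lemma simple_graph_bf: "simple_graph (bf_verts L) (bf_adj L)"
proof -
  let ?f = "\<lambda>v. (bf_level v, bf_word v)"
  have "?f ` bf_verts L \<subseteq> {..L} \<times> Pow {..<L}" by (auto simp: bf_verts_def)
  moreover have "inj_on ?f (bf_verts L)" by (rule inj_onI) (auto intro: bf_eqI)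
  ultimately have "finite (bf_verts L)"
    by (intro finite_imageD[of ?f] finite_subset[of "?f ` bf_verts L"]) auto
  then show ?thesis by (auto simp: simple_graph_def bf_adj_def)
qed

section \<open>The infinite family\<close>

theorem theorem1:
  shows "\<exists>(V :: nat \<Rightarrow> nat set) (E :: nat \<Rightarrow> nat \<Rightarrow> nat \<Rightarrow> bool).
     (\<forall>n. simple_graph (V n) (E n) \<and> connected_graph (V n) (E n) \<and>
          cop_number (V n) (E n) = 2 \<and> max_degree (V n) (E n) = 3) \<and>
     (\<forall>N. \<exists>n. cop_number_V (V n) (E n) > N) \<and>
     (\<forall>N. \<exists>n. cop_number_Vr (V n) (E n) > N) \<and>
     (\<forall>N. \<exists>n. cop_number_E (V n) (E n) > N) \<and>
     (\<forall>N. \<exists>n. cop_number_Er (V n) (E n) > N)"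
proof -
  let ?L = "\<lambda>n::nat. 2 * n + 3"
  have bf: "butterfly (?L n) (bf_verts (?L n)) (bf_adj (?L n)) bf_level bf_word" for n
    by (rule butterfly_bf) simp
  have basic: "simple_graph (bf_verts (?L n)) (bf_adj (?L n)) \<and>
      connected_graph (bf_verts (?L n)) (bf_adj (?L n)) \<and>
      cop_number (bf_verts (?L n)) (bf_adj (?L n)) = 2 \<and>
      max_degree (bf_verts (?L n)) (bf_adj (?L n)) = 3" for n
  proof -
    have "finite (bf_verts (?L n))" using simple_graph_bf[of "?L n"] unfolding simple_graph_def ..
    then have "max_degree (bf_verts (?L n)) (bf_adj (?L n)) = 3"
      by (rule butterfly.max_degree_eq_3[OF bf]) simp
    then show ?thesis
      using simple_graph_bf[of "?L n"] butterfly.connected[OF bf] butterfly.cop_number_eq_2[OF bf]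
      by blast
  qed
  have large: "\<exists>n. N < cop_number_V (bf_verts (?L n)) (bf_adj (?L n)) \<and>
      N < cop_number_Vr (bf_verts (?L n)) (bf_adj (?L n)) \<and>
      N < cop_number_E (bf_verts (?L n)) (bf_adj (?L n)) \<and>
      N < cop_number_Er (bf_verts (?L n)) (bf_adj (?L n))" for N
  proof -
    \<comment> \<open>For \<open>k\<close> up to \<open>2 * N\<close> evasion asks for
      \<open>L\<close> at least \<open>8 * N + 6\<close>; this choice gives
      \<open>8 * N + 7\<close>.\<close>
    let ?n = "4 * N + 2"
    have "4 * k + 6 \<le> ?L ?n" if "k \<le> 2 * N" for k
      using that by simp
    note evade = butterfly.robber_evades[OF bf this]
    show ?thesis
      by (intro exI[of _ ?n] conjI; rule cop_numbers_large[OF simple_graph_bf]; erule evade)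
  qed
  show ?thesis
  proof (intro exI[of _ "\<lambda>n. bf_verts (?L n)"] exI[of _ "\<lambda>n. bf_adj (?L n)"] conjI allI)
    fix N
    show "\<exists>n. N < cop_number_V (bf_verts (?L n)) (bf_adj (?L n))" using large[of N] by blast
    show "\<exists>n. N < cop_number_Vr (bf_verts (?L n)) (bf_adj (?L n))" using large[of N] by blast
    show "\<exists>n. N < cop_number_E (bf_verts (?L n)) (bf_adj (?L n))" using large[of N] by blast
    show "\<exists>n. N < cop_number_Er (bf_verts (?L n)) (bf_adj (?L n))" using large[of N] by blast
  qed (use basic in blast)+
qed

end
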